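(* Let $\mathsf M,n\ge2$. For the $(\mathsf M,n)$ time-sharing Scheme A $\overline{\mathscr C}_{\mathsf A}$ with random-strategy PMF $z=(z_s)_{s\in\{0,\dots,n-1\}^{\mathsf M-1}}$, every server has the same leakage, given by $$\rho^{(\mathsf{MI})}(\overline{\mathscr C}_{\mathsf A})=-\frac1n\sum_{q\in\{0,\dots,n-1\}^{\mathsf M}}\Bigl(\frac1{\mathsf M}\sum_{m=1}^{\mathsf M}z_{q\setminus\{m\}}\Bigr)\log_2\Bigl(\frac1{\mathsf M}\sum_{m=1}^{\mathsf M}z_{q\setminus\{m\}}\Bigr)-H(z),$$ $$\rho^{(\mathsf{MaxL})}(\overline{\mathscr C}_{\mathsf A})=\log_2\sum_{q\in\{0,\dots,n-1\}^{\mathsf M}}\max_{m\in\{1,\dots,\mathsf M\}}\frac{z_{q\setminus\{m\}}}{n}.$$ Moreover, for any download-cost constraint $\mathsf D$, the problem of minimizing $\rho^{(\mathsf{MI})}(\overline{\mathscr C}_{\mathsf A})$, respectively $2^{\rho^{(\mathsf{MaxL})}(\overline{\mathscr C}_{\mathsf A})}$, over $z$ subject to $$1-z_{0}+(n-1)\le\mathsf D,\qquad \sum_{s\in\{0,\dots,n-1\}^{\mathsf M-1}}z_s=1,\qquad z_s\ge0\ \ \forall s$$ (where $z_0$ is the probability of the all-zero vector), is a convex optimization problem, i.e. the objective is a convex function of $z$ and the feasible set is convex.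
   Context: $H(z)=-\sum_sz_s\log_2z_s$ with $0\log_20=0$. For $q=(q_1,\dots,q_{\mathsf M})$, $q\setminus\{m\}=(q_1,\dots,q_{m-1},q_{m+1},\dots,q_{\mathsf M})$. Scheme A: $n$ noncolluding servers each store the same $\mathsf M$ independent files $X^{(m)}=(X_1^{(m)},\dots,X_{n-1}^{(m)})$, uniform on $\{0,1\}^{n-1}$; $X^{(m)}_0:=0$. The requested index $M$ is uniform on $\{1,\dots,\mathsf M\}$, independent of the files. The user draws $S\in\{0,\dots,n-1\}^{\mathsf M-1}$ with PMF $P_S(s)=z_s$, independently of $M$ and the files. If $M=m$, $S=s$, the query with label $l\in\{1,\dots,n\}$ is $q_l=(s_1,\dots,s_{m-1},q_{l,m},s_m,\dots,s_{\mathsf M-1})$ with $q_{l,m}=(l-1-\sum_js_j)\bmod n$, and the answer to it is $X^{(1)}_{q_{l,1}}+\dots+X^{(\mathsf M)}_{q_{l,\mathsf M}}$ (mod 2), of length $0$ if $q_l=0$ and $1$ otherwise. Write $Q_l$ for the random query with label $l$. Time-sharing Scheme A $\overline{\mathscr C}_{\mathsf A}$: the user additionally draws $T$ uniform on $\{1,\dots,n\}$, independent of everything else, and sends to server $l$ the query $\overline Q_l=Q_{\sigma^{T-1}(l)}$, where $\sigma$ is the cyclic permutation of $\{1,\dots,n\}$. Its download cost is $1-z_0+(n-1)$ bits. Leakages: $\rho^{(\mathsf{MI})}(\overline{\mathscr C}_{\mathsf A})=\frac1n\sum_lI(M;\overline Q_l)$ (in bits), with the leakage at server $l$ being $I(M;\overline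 Q_l)$; $\rho^{(\mathsf{MaxL})}(\overline{\mathscr C}_{\mathsf A})=\max_l\log_2\sum_q\max_mP_{\overline Q_l|M}(q|m)$, with the leakage at server $l$ being the $l$-th term of the maximum. *)

theory Defs
  imports "HOL-Probability.Probability" "HOL-Analysis.Finite_Function_Topology"
begin

(* Vectors over {0..n-1} are lists, so the m-th coordinate (m = 1, 2, ...) of q is q ! (m - 1). *)

definition words :: "nat \<Rightarrow> nat \<Rightarrow> nat list set" where
  "words n k = {s. length s = k \<and> set s \<subseteq> {0..<n}}"

definition zero_word :: "nat \<Rightarrow> nat list" where
  "zero_word k = replicate k 0"

definition remove_coord :: "nat \<Rightarrow> nat list \<Rightarrow> nat list" where
  "remove_coord m q = take (m - 1) q @ drop m q"

(* A real vector z indexed by words n (M - 1) is a finitely supported function that vanishes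
   outside words n (M - 1); in this way the vectors live in the real vector space of
   HOL-Analysis.Finite_Function_Topology, on which the library's convex and convex_on apply. *)

definition pmf_vectors :: "nat \<Rightarrow> nat \<Rightarrow> (nat list \<Rightarrow>\<^sub>0 real) set" where
  "pmf_vectors M n = {z. Poly_Mapping.keys z \<subseteq> words n (M - 1) \<and>
     (\<forall>s\<in>words n (M - 1). 0 \<le> Poly_Mapping.lookup z s) \<and> (\<Sum>s\<in>words n (M - 1). Poly_Mapping.lookup z s) = 1}"

definition feasible :: "nat \<Rightarrow> nat \<Rightarrow> real \<Rightarrow> (nat list \<Rightarrow>\<^sub>0 real) set" where
  "feasible M n D = {z \<in> pmf_vectors M n. 1 - Poly_Mapping.lookup z (zero_word (M - 1)) + (real n - 1) \<le> D}"

definition vector_entropy :: "nat \<Rightarrow> nat \<Rightarrow> (nat list \<Rightarrow>\<^sub>0 real) \<Rightarrow> real" where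
  "vector_entropy M n z = - (\<Sum>s\<in>words n (M - 1). Poly_Mapping.lookup z s * log 2 (Poly_Mapping.lookup z s))"

definition scheme_query :: "nat \<Rightarrow> nat \<Rightarrow> nat list \<Rightarrow> nat \<Rightarrow> nat list" where
  "scheme_query n m s l =
     take (m - 1) s @ [nat ((int l - 1 - int (sum_list s)) mod int n)] @ drop (m - 1) s"

type_synonym files = "nat \<Rightarrow> nat \<Rightarrow> nat"

(* x m i is the bit X_i of the m-th file, for i in {1..n-1}. *)
definition all_files :: "nat \<Rightarrow> nat \<Rightarrow> files set" where
  "all_files M n = {1..M} \<rightarrow>\<^sub>E ({1..n - 1} \<rightarrow>\<^sub>E {0, 1})"

definition file_symbol :: "files \<Rightarrow> nat \<Rightarrow> nat \<Rightarrow> nat" where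
  "file_symbol x m i = (if i = 0 then 0 else x m i)"

definition answer :: "nat \<Rightarrow> files \<Rightarrow> nat list \<Rightarrow> nat list" where
  "answer M x q =
     (if q = zero_word M then [] else [(\<Sum>m = 1..M. file_symbol x m (q ! (m - 1))) mod 2])"

definition cyclic_shift :: "nat \<Rightarrow> nat \<Rightarrow> nat" where
  "cyclic_shift n l = (if l = n then 1 else l + 1)"

(* Outcomes are (m, s, t, x): the requested index, the random strategy, the time-sharing
   variable and the files. *)
type_synonym outcome = "nat \<times> nat list \<times> nat \<times> files"

definition requested :: "outcome \<Rightarrow> nat" where
  "requested = (\<lambda>(m, s, t, x). m)"

(* embed_pmf is meaningful only for z in pmf_vectors M n; see pmf_embed_lookup below. *)
definition scheme_pmf :: "nat \<Rightarrow> nat \<Rightarrow> (nat list \<Rightarrow>\<^sub>0 real) \<Rightarrow> outcome pmf" where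
  "scheme_pmf M n z =
     pair_pmf (pmf_of_set {1..M}) (pair_pmf (embed_pmf (Poly_Mapping.lookup z))
       (pair_pmf (pmf_of_set {1..n}) (pmf_of_set (all_files M n))))"

definition shared_query :: "nat \<Rightarrow> nat \<Rightarrow> outcome \<Rightarrow> nat list" where
  "shared_query n l = (\<lambda>(m, s, t, x). scheme_query n m s ((cyclic_shift n ^^ (t - 1)) l))"

definition download_cost :: "nat \<Rightarrow> nat \<Rightarrow> (nat list \<Rightarrow>\<^sub>0 real) \<Rightarrow> real" where
  "download_cost M n z = measure_pmf.expectation (scheme_pmf M n z)
     (\<lambda>\<omega>. \<Sum>l = 1..n. real (length (answer M (snd (snd (snd \<omega>))) (shared_query n l \<omega>))))"


lemma pmf_embed_lookup:
  assumes "z \<in> pmf_vectors M n"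
  shows "pmf (embed_pmf (Poly_Mapping.lookup z)) s = Poly_Mapping.lookup z s"
proof -
  let ?f = "Poly_Mapping.lookup z"
  have keys: "Poly_Mapping.keys z \<subseteq> words n (M - 1)"
    and nn: "\<And>s. s \<in> words n (M - 1) \<Longrightarrow> 0 \<le> ?f s"
    and one: "(\<Sum>s\<in>words n (M - 1). ?f s) = 1"
    using assms by (auto simp: pmf_vectors_def)
  have fin: "finite (words n (M - 1))"
    unfolding words_def using finite_lists_length_eq[of "{0..<n}" "M - 1"] by (simp add: conj_commute)
  have zero: "?f s = 0" if "s \<notin> words n (M - 1)" for s
    using keys that by (meson in_keys_iff subsetD)
  have nonneg: "0 \<le> ?f s" for s
    using nn zero by (cases "s \<in> words n (M - 1)") auto
  have "(\<integral>\<^sup>+s. ennreal (?f s) \<partial>count_space UNIV) = (\<Sum>s\<in>words n (M - 1). ennreal (?f s))"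
    by (rule nn_integral_count_space') (use fin zero in auto)
  also have "\<dots> = 1" using one nn by (simp add: sum_ennreal)
  finally show ?thesis
    using nonneg by (intro pmf_embed_pmf) auto
qed

lemma set_embed_lookup:
  assumes "z \<in> pmf_vectors M n"
  shows "set_pmf (embed_pmf (Poly_Mapping.lookup z)) \<subseteq> words n (M - 1)"
  using assms pmf_embed_lookup[OF assms]
  by (auto simp: set_pmf_eq pmf_vectors_def in_keys_iff subset_eq)

lemma scheme_query_eq_zero_iff:
  assumes "s \<in> words n (M - 1)" "m \<in> {1..M}" "l \<in> {1..n}"
  shows "scheme_query n m s l = zero_word M \<longleftrightarrow> s = zero_word (M - 1) \<and> l = 1"
proof -
  have len: "length s = M - 1" using assms(1) by (simp add: words_def)
  have mod0: "nat ((int l - 1) mod int n) = 0 \<longleftrightarrow> l = 1"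
    using assms(3) by auto
  have rep: "xs = replicate k 0 \<longleftrightarrow> length xs = k \<and> set xs \<subseteq> {0}" for xs :: "nat list" and k
    by (auto intro!: replicate_eqI)
  have "length (scheme_query n m s l) = M"
    using len assms(2) by (auto simp: scheme_query_def)
  then have "scheme_query n m s l = zero_word M \<longleftrightarrow> set (scheme_query n m s l) \<subseteq> {0}"
    by (simp add: zero_word_def rep)
  also have "\<dots> \<longleftrightarrow> set (take (m - 1) s @ drop (m - 1) s) \<subseteq> {0} \<and>
      nat ((int l - 1 - int (sum_list s)) mod int n) = 0"
    unfolding scheme_query_def set_append by auto
  also have "\<dots> \<longleftrightarrow> s = zero_word (M - 1) \<and> nat ((int l - 1 - int (sum_list s)) mod int n) = 0"
    using len by (simp only: append_take_drop_id zero_word_def rep simp_thms)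
  also have "\<dots> \<longleftrightarrow> s = zero_word (M - 1) \<and> l = 1"
    using mod0 by (auto simp: zero_word_def sum_list_replicate)
  finally show ?thesis .
qed

lemma bij_cyclic_shift_pow: "bij_betw (cyclic_shift n ^^ k) {1..n} {1..n}"
proof (induction k)
  case 0
  show ?case by (simp add: bij_betw_def)
next
  case (Suc k)
  have sub: "cyclic_shift n ` {1..n} \<subseteq> {1..n}"
    by (auto simp: cyclic_shift_def)
  have "inj_on (cyclic_shift n) {1..n}"
    by (auto simp: inj_on_def cyclic_shift_def split: if_splits)
  then have "bij_betw (cyclic_shift n) {1..n} {1..n}"
    using endo_inj_surj[OF finite_atLeastAtMost sub] by (simp add: bij_betw_def)
  then show ?case
    using bij_betw_trans[OF Suc] by (simp only: funpow.simps)
qed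

(* The expression bounded by D in feasible is the download cost. *)
lemma download_cost_eq:
  assumes "M \<ge> 2" "n \<ge> 2" "z \<in> pmf_vectors M n"
  shows "download_cost M n z = 1 - Poly_Mapping.lookup z (zero_word (M - 1)) + (real n - 1)"
proof -
  let ?p = "scheme_pmf M n z"
  let ?Z = "{\<omega>. fst (snd \<omega>) = zero_word (M - 1)} :: outcome set"
  have pt: "(\<Sum>l = 1..n. real (length (answer M (snd (snd (snd \<omega>))) (shared_query n l \<omega>)))) =
      real n - indicator ?Z \<omega>" if "\<omega> \<in> set_pmf ?p" for \<omega>
  proof -
    obtain m s t x where w: "\<omega> = (m, s, t, x)" by (cases \<omega>) auto
    have m: "m \<in> {1..M}" and s: "s \<in> words n (M - 1)"
      using that set_embed_lookup[OF assms(3)] assms(1) by (auto simp: w scheme_pmf_def)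
    let ?g = "\<lambda>l. real (length (answer M x (scheme_query n m s l)))"
    have "(\<Sum>l = 1..n. ?g ((cyclic_shift n ^^ (t - 1)) l)) = (\<Sum>l = 1..n. ?g l)"
      by (rule sum.reindex_bij_betw[OF bij_cyclic_shift_pow])
    also have "\<dots> = (\<Sum>l = 1..n. 1 - (if l = 1 then indicator ?Z \<omega> else 0))"
      by (rule sum.cong) (auto simp: answer_def scheme_query_eq_zero_iff[OF s m] w)
    also have "\<dots> = real n - indicator ?Z \<omega>"
      using assms(2) by (simp add: sum_subtractf sum.delta)
    finally show ?thesis by (simp add: w shared_query_def)
  qed
  have "download_cost M n z = measure_pmf.expectation ?p (\<lambda>\<omega>. real n - indicator ?Z \<omega>)"
    unfolding download_cost_def
    by (rule integral_cong_AE) (simp, simp, use pt in \<open>blast intro: AE_pmfI\<close>)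
  also have "\<dots> = real n - measure_pmf.prob ?p ?Z"
    by (subst Bochner_Integration.integral_diff)
      (auto intro: measure_pmf.integrable_const_bound[where B = 1] simp: indicator_def)
  also have "measure_pmf.prob ?p ?Z =
      measure_pmf.prob (map_pmf fst (map_pmf snd ?p)) {zero_word (M - 1)}"
    by (simp add: vimage_def)
  also have "\<dots> = Poly_Mapping.lookup z (zero_word (M - 1))"
    using pmf_embed_lookup[OF assms(3)]
    by (simp add: scheme_pmf_def map_fst_pair_pmf map_snd_pair_pmf measure_pmf_single)
  finally show ?thesis by simp
qed

definition server_MI :: "nat \<Rightarrow> nat \<Rightarrow> (nat list \<Rightarrow>\<^sub>0 real) \<Rightarrow> nat \<Rightarrow> real" where
  "server_MI M n z l =
     prob_space.mutual_information (measure_pmf (scheme_pmf M n z)) 2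
       (count_space UNIV) (count_space UNIV) requested (shared_query n l)"

definition server_MaxL :: "nat \<Rightarrow> nat \<Rightarrow> (nat list \<Rightarrow>\<^sub>0 real) \<Rightarrow> nat \<Rightarrow> real" where
  "server_MaxL M n z l = log 2 (\<Sum>q\<in>words n M. MAX m\<in>{1..M}.
     \<P>(\<omega> in measure_pmf (scheme_pmf M n z). shared_query n l \<omega> = q \<bar> requested \<omega> = m))"

definition rho_MI :: "nat \<Rightarrow> nat \<Rightarrow> (nat list \<Rightarrow>\<^sub>0 real) \<Rightarrow> real" where
  "rho_MI M n z = 1 / real n * (\<Sum>l = 1..n. server_MI M n z l)"

definition rho_MaxL :: "nat \<Rightarrow> nat \<Rightarrow> (nat list \<Rightarrow>\<^sub>0 real) \<Rightarrow> real" where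
  "rho_MaxL M n z = (MAX l\<in>{1..n}. server_MaxL M n z l)"

end

(* A query q and the requested index m determine the strategy s = q with its m-th coordinate
   deleted, and, at a given server, exactly one of the n values of the time-sharing variable.
   Hence P(Q = q | M = m) is 1/n times the entry of z at q without its m-th coordinate, at every
   server, and both leakage formulas follow.
   The mutual information is thus 1/(nM) times a sum of terms a log (a / A), with a and A linear in
   z, and (a, A) |-> a log (a / A) is jointly convex; 2 to the maximal leakage is a sum of maxima
   of linear functions of z. *)

theory Submission
  imports Defs
begin

section \<open>The vector space of PMF vectors, the feasible set, and general convexity
  facts\<close>

lemma lookup_scaleR:
  "Poly_Mapping.lookup (r *\<^sub>R z) i = r *\<^sub>R Poly_Mapping.lookup z i"
proof -
  \<comment> \<open>The scalar multiple is defined through \<open>Abs_poly_mapping\<close>, whose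
    inverse law asks for finite support.\<close>
  have "finite {i. r *\<^sub>R Poly_Mapping.lookup z i \<noteq> 0}"
    by (rule finite_subset[OF _ finite_lookup[of z]]) auto
  then show ?thesis
    by (simp add: scaleR_poly_mapping_def Abs_poly_mapping_inverse)
qed

lemma linear_lookup: "linear (\<lambda>z. Poly_Mapping.lookup z i :: real)"
  by (rule linearI) (simp_all add: lookup_add lookup_scaleR)

lemma finite_words: "finite (words n k)"
  unfolding words_def using finite_lists_length_eq[of "{0..<n}" k] by (simp add: conj_commute)

lemma convex_pmf_vectors: "convex (pmf_vectors M n)"
proof (rule convexI)
  fix x y and u v :: real
  assume xy: "x \<in> pmf_vectors M n" "y \<in> pmf_vectors M n" and uv: "0 \<le> u" "0 \<le> v" "u + v = 1"
  have "(\<Sum>s\<in>words n (M - 1). Poly_Mapping.lookup (u *\<^sub>R x + v *\<^sub>R y) s) = 1"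
    using xy uv
    by (simp add: pmf_vectors_def lookup_add lookup_scaleR sum.distrib flip: sum_distrib_left)
  moreover have "Poly_Mapping.keys (u *\<^sub>R x + v *\<^sub>R y) \<subseteq> words n (M - 1)"
  proof
    fix s assume "s \<in> Poly_Mapping.keys (u *\<^sub>R x + v *\<^sub>R y)"
    then have "s \<in> Poly_Mapping.keys x \<or> s \<in> Poly_Mapping.keys y"
      by (auto simp: in_keys_iff lookup_add lookup_scaleR)
    then show "s \<in> words n (M - 1)"
      using xy by (auto simp: pmf_vectors_def)
  qed
  ultimately show "u *\<^sub>R x + v *\<^sub>R y \<in> pmf_vectors M n"
    using xy uv by (auto simp: pmf_vectors_def lookup_add lookup_scaleR)
qed

lemma convex_feasible: "convex (feasible M n D)"
proof -
  let ?L = "\<lambda>z. Poly_Mapping.lookup z (zero_word (M - 1)) :: real"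
  \<comment> \<open>The cost constraint rearranges to a lower bound \<open>n - D\<close> on the
    entry at the zero word, which is a half-space.\<close>
  have "feasible M n D = pmf_vectors M n \<inter> ?L -` {real n - D..}"
    by (auto simp: feasible_def)
  moreover have "convex (?L -` {real n - D..})"
    using linear_lookup convex_real_interval(1) by (rule convex_linear_vimage)
  ultimately show ?thesis
    by (simp add: convex_Int convex_pmf_vectors)
qed

text \<open>The entries are values of a PMF at every list, so membership of \<open>s\<close> in
  \<open>words n (M - 1)\<close> never has to be checked.\<close>

lemma lookup_nonneg:
  assumes "z \<in> pmf_vectors M n"
  shows "0 \<le> Poly_Mapping.lookup z s"
  using pmf_nonneg[of "embed_pmf (Poly_Mapping.lookup z)" s] pmf_embed_lookup[OF assms, of s] by simp

(* The right-hand side is convex and homogeneous in (x, y), and the left-hand side is its linear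
   minorant touching it along the ray x = r y. *)
lemma xlnx_ge_tangent:
  fixes x y r :: real
  assumes "0 \<le> x" "0 \<le> y" "y = 0 \<Longrightarrow> x = 0" "0 < r"
  shows "x * ln r + x - r * y \<le> x * ln (x / y)"
proof (cases "x = 0")
  case True
  then show ?thesis using assms by simp
next
  case False
  then have pos: "0 < x" "0 < y" using assms by (auto simp: less_le)
  have "ln (r * y / x) \<le> r * y / x - 1"
    using pos assms by (intro ln_le_minus_one) simp
  then have "x * ln (r * y / x) \<le> r * y - x"
    using pos by (simp add: field_simps)
  moreover have "ln (r * y / x) = ln r - ln (x / y)"
    using pos assms by (simp add: ln_div ln_mult)
  ultimately show ?thesis
    by (simp add: algebra_simps)
qed

text \<open>Supporting-plane argument: the minorant of \<open>xlnx_ge_tangent\<close>, with r the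
  ratio f / g at the mixture, is linear in (f, g), exact at the mixture and below the function at
  both endpoints. The condition that f vanishes wherever g does keeps the default value of division
  by 0 harmless.\<close>

lemma convex_on_xlogx_over_linear:
  fixes f g :: "'a::real_vector \<Rightarrow> real"
  assumes "convex S" and lin: "linear f" "linear g"
    and nn: "\<And>x. x \<in> S \<Longrightarrow> 0 \<le> f x" "\<And>x. x \<in> S \<Longrightarrow> 0 \<le> g x"
    and ac: "\<And>x. x \<in> S \<Longrightarrow> g x = 0 \<Longrightarrow> f x = 0"
    and b: "1 < b"
  shows "convex_on S (\<lambda>x. f x * log b (f x / g x))"
proof -
  have "convex_on S (\<lambda>x. f x * ln (f x / g x))"
  proof
    fix t :: real and x y
    assume t: "0 < t" "t < 1" and xy: "x \<in> S" "y \<in> S"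
    let ?w = "(1 - t) *\<^sub>R x + t *\<^sub>R y"
    have w: "?w \<in> S"
      using convexD_alt[OF \<open>convex S\<close> xy] t by simp
    have fw: "f ?w = (1 - t) * f x + t * f y" and gw: "g ?w = (1 - t) * g x + t * g y"
      using lin by (simp_all add: linear_add linear_scale)
    show "f ?w * ln (f ?w / g ?w) \<le> (1 - t) * (f x * ln (f x / g x)) + t * (f y * ln (f y / g y))"
    proof (cases "f ?w = 0")
      \<comment> \<open>The ratio would be 0 here, outside the range of the minorant; but f then
        vanishes at both endpoints, and both sides are 0.\<close>
      case True
      then have "(1 - t) * f x = 0" "t * f y = 0"
        using nn(1)[OF xy(1)] nn(1)[OF xy(2)] t unfolding fw
        by (simp_all add: add_nonneg_eq_0_iff)
      then have zero: "(1 - t) * (f x * ln (f x / g x)) = 0" "t * (f y * ln (f y / g y)) = 0"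
        by auto
      show ?thesis unfolding True zero by simp
    next
      case False
      define r where "r = f ?w / g ?w"
      have pos: "0 < f ?w" "0 < g ?w"
        using False ac[OF w] nn[OF w] by (auto simp: less_le)
      then have r: "0 < r" "r * g ?w = f ?w"
        by (simp_all add: r_def)
      \<comment> \<open>By the choice of r, the terms f - r g at the endpoints average to 0.\<close>
      have "f ?w * ln r = (1 - t) * (f x * ln r + f x - r * g x) + t * (f y * ln r + f y - r * g y)"
        using r(2) unfolding fw gw by (simp add: algebra_simps)
      also have "\<dots> \<le> (1 - t) * (f x * ln (f x / g x)) + t * (f y * ln (f y / g y))"
        using t r nn ac xy by (intro add_mono mult_left_mono xlnx_ge_tangent) auto
      finally show ?thesis by (simp add: r_def)
    qed
  qed (rule assms)
  then have "convex_on S (\<lambda>x. 1 / ln b * (f x * ln (f x / g x)))"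
    using b by (intro convex_on_cmul) auto
  then show ?thesis by (simp add: log_def field_simps)
qed

lemma convex_on_Max:
  fixes f :: "'i \<Rightarrow> 'a::real_vector \<Rightarrow> real"
  assumes "finite I" "I \<noteq> {}" "\<And>i. i \<in> I \<Longrightarrow> convex_on S (f i)"
  shows "convex_on S (\<lambda>x. MAX i\<in>I. f i x)"
proof
  fix t :: real and x y
  assume t: "0 < t" "t < 1" and xy: "x \<in> S" "y \<in> S"
  have "f i ((1 - t) *\<^sub>R x + t *\<^sub>R y) \<le> (1 - t) * (MAX i\<in>I. f i x) + t * (MAX i\<in>I. f i y)"
    if "i \<in> I" for i
  proof -
    have "f i ((1 - t) *\<^sub>R x + t *\<^sub>R y) \<le> (1 - t) * f i x + t * f i y"
      using convex_onD[OF assms(3)[OF that]] t xy by simp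
    also have "\<dots> \<le> (1 - t) * (MAX i\<in>I. f i x) + t * (MAX i\<in>I. f i y)"
      using t that assms(1) by (intro add_mono mult_left_mono Max_ge) auto
    finally show ?thesis .
  qed
  then show "(MAX i\<in>I. f i ((1 - t) *\<^sub>R x + t *\<^sub>R y)) \<le> (1 - t) * (MAX i\<in>I. f i x) + t * (MAX i\<in>I. f i y)"
    using assms by simp
qed (use assms convex_on_imp_convex in blast)

text \<open>Convexity of S is assumed for the empty or infinite index set: the sum is then the
  constant 0, and \<open>convex_on\<close> still demands a convex domain.\<close>

lemma convex_on_sum_fun:
  fixes f :: "'i \<Rightarrow> 'a::real_vector \<Rightarrow> real"
  assumes "convex S" "\<And>i. i \<in> I \<Longrightarrow> convex_on S (f i)"
  shows "convex_on S (\<lambda>x. \<Sum>i\<in>I. f i x)"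
  using assms(2)
  by (induction I rule: infinite_finite_induct) (auto simp: convex_on_const assms(1))

section \<open>Combinatorics of queries, strategies and time slots\<close>

text \<open>Labels start at 1, so shifting becomes addition modulo n only after subtracting 1. In
  this form the time slot enters the label additively.\<close>

lemma funpow_cyclic_shift:
  assumes "l \<in> {1..n}"
  shows "(cyclic_shift n ^^ k) l = (l - 1 + k) mod n + 1"
proof (induction k)
  case 0
  then show ?case using assms by auto
next
  case (Suc k)
  then show ?case by (simp add: cyclic_shift_def mod_Suc)
qed

text \<open>Both lists are cut around index m - 1, where q has one entry more than s: the outer
  pieces determine s, and the inserted entry leaves a congruence, stated over the integers so that
  it can be solved for the label.\<close>

lemma scheme_query_eq_iff:
  assumes "s \<in> words n (M - 1)" "m \<in> {1..M}" "q \<in> words n M"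
  shows "scheme_query n m s l = q \<longleftrightarrow>
    s = remove_coord m q \<and> (int l - 1 - int (sum_list s)) mod int n = int (q ! (m - 1))"
proof -
  have len: "length s = M - 1" "length q = M" "m - 1 < length q"
    using assms by (auto simp: words_def)
  then have "q ! (m - 1) \<in> set q" by simp
  then have n: "n > 0" using assms(3) by (auto simp: words_def)
  have q: "q = take (m - 1) q @ [q ! (m - 1)] @ drop m q"
    using id_take_nth_drop[OF len(3)] assms(2) by simp
  have "scheme_query n m s l = q \<longleftrightarrow> take (m - 1) s = take (m - 1) q \<and>
    nat ((int l - 1 - int (sum_list s)) mod int n) = q ! (m - 1) \<and> drop (m - 1) s = drop m q"
    using len assms(2) by (subst q) (simp add: scheme_query_def)
  also have "take (m - 1) s = take (m - 1) q \<and>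
    nat ((int l - 1 - int (sum_list s)) mod int n) = q ! (m - 1) \<and> drop (m - 1) s = drop m q \<longleftrightarrow>
    s = remove_coord m q \<and> nat ((int l - 1 - int (sum_list s)) mod int n) = q ! (m - 1)"
  proof -
    have "s = remove_coord m q \<longleftrightarrow> take (m - 1) s @ drop (m - 1) s = take (m - 1) q @ drop m q"
      by (simp add: remove_coord_def)
    also have "\<dots> \<longleftrightarrow> take (m - 1) s = take (m - 1) q \<and> drop (m - 1) s = drop m q"
      using len assms(2) by (intro append_eq_append_conv) auto
    finally show ?thesis by blast
  qed
  also have "nat ((int l - 1 - int (sum_list s)) mod int n) = q ! (m - 1) \<longleftrightarrow>
      (int l - 1 - int (sum_list s)) mod int n = int (q ! (m - 1))"
    using n by (simp add: nat_eq_iff)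
  finally show ?thesis .
qed

text \<open>For the shifted label the congruence is linear in t - 1 with coefficient 1, so exactly
  one of the n slots solves it. The slot is independent of s because s is already forced to be
  \<open>remove_coord m q\<close>.\<close>

lemma ex_time_slot:
  assumes "m \<in> {1..M}" "q \<in> words n M" "l \<in> {1..n}"
  obtains t0 where "t0 \<in> {1..n}"
    "\<And>s t. s \<in> words n (M - 1) \<Longrightarrow> t \<in> {1..n} \<Longrightarrow>
      scheme_query n m s ((cyclic_shift n ^^ (t - 1)) l) = q \<longleftrightarrow> s = remove_coord m q \<and> t = t0"
proof -
  \<comment> \<open>Solution for t - 1 of \<open>l - 1 + (t - 1) - sum = q ! (m - 1)\<close> modulo
    n; the + 1 in \<open>t0\<close> returns to slots counted from 1.\<close>
  define c where "c = int (q ! (m - 1)) + int (sum_list (remove_coord m q)) - int l + 1"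
  define t0 where "t0 = nat (c mod int n) + 1"
  have n: "n > 0" using assms(3) by auto
  have "q ! (m - 1) \<in> set q" using assms(1,2) by (auto simp: words_def)
  then have qn: "q ! (m - 1) < n" using assms(2) by (auto simp: words_def)
  have "nat (c mod int n) < n"
    using n by (simp add: nat_less_iff)
  then have t0: "t0 \<in> {1..n}"
    by (simp add: t0_def)
  have "scheme_query n m s ((cyclic_shift n ^^ (t - 1)) l) = q \<longleftrightarrow> s = remove_coord m q \<and> t = t0"
    if s: "s \<in> words n (M - 1)" and t: "t \<in> {1..n}" for s t
  proof -
    let ?S = "int (sum_list (remove_coord m q))"
    have label: "(int ((cyclic_shift n ^^ (t - 1)) l) - 1 - ?S) mod int n = (int l - 1 + int (t - 1) - ?S) mod int n"
      using assms(3) by (simp add: funpow_cyclic_shift zmod_int mod_diff_left_eq algebra_simps)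
    have "(int l - 1 + int (t - 1) - ?S) mod int n = int (q ! (m - 1)) \<longleftrightarrow>
        (int l - 1 + int (t - 1) - ?S) mod int n = int (q ! (m - 1)) mod int n"
      using qn by simp
    also have "\<dots> \<longleftrightarrow> int (t - 1) mod int n = c mod int n"
      unfolding mod_eq_dvd_iff c_def by (simp add: algebra_simps)
    also have "\<dots> \<longleftrightarrow> t = t0"
      using t n by (auto simp: t0_def)
    finally have "(int ((cyclic_shift n ^^ (t - 1)) l) - 1 - ?S) mod int n = int (q ! (m - 1)) \<longleftrightarrow> t = t0"
      unfolding label .
    then show ?thesis
      unfolding scheme_query_eq_iff[OF s assms(1,2)] by (metis (no_types))
  qed
  with t0 that show thesis by blast
qed

text \<open>A word of length M amounts to a shorter word together with one of n values for the
  deleted entry. This recovers the entropy of z and its total mass 1 from sums over queries.\<close>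

lemma sum_words_remove_coord:
  fixes f :: "nat list \<Rightarrow> real"
  assumes "m \<in> {1..M}"
  shows "(\<Sum>q\<in>words n M. f (remove_coord m q)) = real n * (\<Sum>s\<in>words n (M - 1). f s)"
proof -
  have "(\<Sum>(s, c)\<in>words n (M - 1) \<times> {0..<n}. f s) = (\<Sum>q\<in>words n M. f (remove_coord m q))"
  proof (rule sum.reindex_bij_witness[where j = "\<lambda>(s, c). take (m - 1) s @ [c] @ drop (m - 1) s"
        and i = "\<lambda>q. (remove_coord m q, q ! (m - 1))"], goal_cases)
    case (1 a)
    then show ?case using assms
      by (auto simp: words_def remove_coord_def nth_append min_def Suc_diff_le)
  next
    case (2 a)
    then show ?case using assms
      by (auto simp: words_def dest!: in_set_takeD in_set_dropD)
  next
    case (3 q)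
    then show ?case using assms id_take_nth_drop[of "m - 1" q]
      by (auto simp: words_def remove_coord_def min_def)
  next
    case (4 q)
    then show ?case using assms
      by (auto simp: words_def remove_coord_def subset_iff dest!: in_set_takeD in_set_dropD)
  next
    case (5 a)
    then show ?case using assms
      by (auto simp: words_def remove_coord_def nth_append min_def Suc_diff_le)
  qed
  then show ?thesis
    by (simp add: sum.cartesian_product[symmetric] sum_distrib_left)
qed


lemma scheme_query_in_words:
  assumes "n > 0" "m \<in> {1..M}" "s \<in> words n (M - 1)"
  shows "scheme_query n m s l \<in> words n M"
  using assms
  by (auto simp: words_def scheme_query_def nat_less_iff dest!: in_set_takeD in_set_dropD)

section \<open>Mutual information and marginals of discrete laws\<close>

text \<open>Countability identifies the product of the two counting measures with the counting
  measure on pairs, and finite support turns the integral into a sum. S may exceed the support, so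
  that the sum can run over a full product set.\<close>

lemma mutual_information_measure_pmf:
  fixes X :: "'a \<Rightarrow> 'b::countable" and Y :: "'a \<Rightarrow> 'c::countable" and p :: "'a pmf"
  defines "J \<equiv> map_pmf (\<lambda>\<omega>. (X \<omega>, Y \<omega>)) p"
  assumes "1 < b" "finite S" "set_pmf J \<subseteq> S"
  shows "prob_space.mutual_information (measure_pmf p) b (count_space UNIV) (count_space UNIV) X Y =
    (\<Sum>w\<in>S. pmf J w * log b (pmf J w / (pmf (map_pmf X p) (fst w) * pmf (map_pmf Y p) (snd w))))"
proof -
  interpret information_space "measure_pmf p" b
    by unfold_locales (rule assms)
  have dist: "distributed (measure_pmf p) (count_space UNIV) Z (\<lambda>x. ennreal (pmf (map_pmf Z p) x))"
    for Z :: "'a \<Rightarrow> 'd"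
    unfolding distributed_def
    by (simp add: measure_pmf_eq_density[symmetric] map_pmf_rep_eq[symmetric])
  have prod: "count_space UNIV \<Otimes>\<^sub>M count_space UNIV = (count_space UNIV :: ('b \<times> 'c) measure)"
    by (subst pair_measure_countable) auto
  let ?f = "\<lambda>w. pmf J w * log b (pmf J w / (pmf (map_pmf X p) (fst w) * pmf (map_pmf Y p) (snd w)))"
  have supp: "{w. ?f w \<noteq> 0} \<subseteq> S"
    using assms(4) by (auto simp: set_pmf_iff)
  have "prob_space.mutual_information (measure_pmf p) b (count_space UNIV) (count_space UNIV) X Y =
      (\<integral>w. ?f w \<partial>(count_space UNIV \<Otimes>\<^sub>M count_space UNIV))"
    by (rule mutual_information_distr[where Pxy = "pmf J" and Px = "pmf (map_pmf X p)"
          and Py = "pmf (map_pmf Y p)"])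
      (simp_all add: sigma_finite_measure_count_space dist prod J_def)
  also have "\<dots> = (\<Sum>w | ?f w \<noteq> 0. ?f w)"
    using finite_subset[OF supp assms(3)]
    by (simp only: prod) (subst lebesgue_integral_count_space_finite_support, simp_all)
  also have "\<dots> = (\<Sum>w\<in>S. ?f w)"
    using supp assms(3) by (intro sum.mono_neutral_left) auto
  finally show ?thesis .
qed

lemma pmf_map_snd:
  assumes "finite A" "set_pmf J \<subseteq> A \<times> UNIV"
  shows "pmf (map_pmf snd J) y = (\<Sum>x\<in>A. pmf J (x, y))"
proof -
  have "pmf (map_pmf snd J) y = measure_pmf.prob J (snd -` {y})"
    by (rule pmf_map)
  also have "\<dots> = measure_pmf.prob J (A \<times> {y})"
    by (rule measure_pmf.finite_measure_eq_AE) (use assms in \<open>auto intro!: AE_pmfI\<close>)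
  also have "\<dots> = (\<Sum>x\<in>A. pmf J (x, y))"
    using assms(1) by (simp add: measure_measure_pmf_finite sum.cartesian_product')
  finally show ?thesis .
qed

section \<open>Joint law of the requested index and the query at one server\<close>

abbreviation joint_pmf :: "nat \<Rightarrow> nat \<Rightarrow> (nat list \<Rightarrow>\<^sub>0 real) \<Rightarrow> nat \<Rightarrow> (nat \<times> nat list) pmf" where
  "joint_pmf M n z l \<equiv> map_pmf (\<lambda>\<omega>. (requested \<omega>, shared_query n l \<omega>)) (scheme_pmf M n z)"

context
  fixes M n :: nat and z :: "nat list \<Rightarrow>\<^sub>0 real" and l :: nat
  assumes M: "M > 0" and z: "z \<in> pmf_vectors M n" and l: "l \<in> {1..n}"
begin

lemma set_scheme_pmf:
  assumes "(m, s, t, x) \<in> set_pmf (scheme_pmf M n z)"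
  shows "m \<in> {1..M}" "s \<in> words n (M - 1)" "t \<in> {1..n}"
  using assms M l set_embed_lookup[OF z] by (auto simp: scheme_pmf_def)

lemma set_joint_pmf: "set_pmf (joint_pmf M n z l) \<subseteq> {1..M} \<times> words n M"
proof -
  have "(requested \<omega>, shared_query n l \<omega>) \<in> {1..M} \<times> words n M"
    if "\<omega> \<in> set_pmf (scheme_pmf M n z)" for \<omega>
  proof -
    obtain m s t x where w: "\<omega> = (m, s, t, x)" by (cases \<omega>) auto
    note mst = set_scheme_pmf(1,2)[OF that[unfolded w]]
    have "n > 0" using l by auto
    then show ?thesis
      using scheme_query_in_words[OF _ mst] mst(1) unfolding w requested_def shared_query_def by simp
  qed
  then show ?thesis by (auto simp only: set_map_pmf)
qed

lemma map_requested: "map_pmf requested (scheme_pmf M n z) = pmf_of_set {1..M}"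
proof -
  have "requested = fst" by (auto simp: requested_def)
  then show ?thesis by (simp add: scheme_pmf_def map_fst_pair_pmf)
qed

lemma pmf_joint:
  assumes "m \<in> {1..M}" "q \<in> words n M"
  shows "pmf (joint_pmf M n z l) (m, q) = Poly_Mapping.lookup z (remove_coord m q) / (real M * real n)"
proof -
  obtain t0 where t0: "t0 \<in> {1..n}"
    "\<And>s t. s \<in> words n (M - 1) \<Longrightarrow> t \<in> {1..n} \<Longrightarrow>
      scheme_query n m s ((cyclic_shift n ^^ (t - 1)) l) = q \<longleftrightarrow> s = remove_coord m q \<and> t = t0"
    using ex_time_slot[OF assms l] by metis
  \<comment> \<open>Projection that drops the files. Almost surely the event becomes one point of a
    product PMF, whose mass is the product of 1 / M, an entry of z and 1 / n.\<close>
  let ?h = "apsnd (apsnd fst) :: outcome \<Rightarrow> _"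
  have eq: "(requested \<omega>, shared_query n l \<omega>) = (m, q) \<longleftrightarrow> ?h \<omega> = (m, remove_coord m q, t0)"
    if "\<omega> \<in> set_pmf (scheme_pmf M n z)" for \<omega>
  proof -
    obtain m' s t x where w: "\<omega> = (m', s, t, x)" by (cases \<omega>) auto
    show ?thesis
      using set_scheme_pmf(2,3)[of m' s t x] that t0(2) unfolding w
      by (auto simp: requested_def shared_query_def)
  qed
  have "pmf (joint_pmf M n z l) (m, q) = pmf (map_pmf ?h (scheme_pmf M n z)) (m, remove_coord m q, t0)"
    unfolding pmf_map
    by (rule measure_pmf.finite_measure_eq_AE) (use eq in \<open>auto intro!: AE_pmfI\<close>)
  also have "map_pmf ?h (scheme_pmf M n z) = pair_pmf (pmf_of_set {1..M})
      (pair_pmf (embed_pmf (Poly_Mapping.lookup z)) (pmf_of_set {1..n}))"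
    by (simp add: scheme_pmf_def pair_map_pmf2[symmetric] map_fst_pair_pmf)
  also have "pmf \<dots> (m, remove_coord m q, t0) =
      Poly_Mapping.lookup z (remove_coord m q) / (real M * real n)"
    using assms t0(1) M l by (simp add: pmf_pair pmf_embed_lookup[OF z])
  finally show ?thesis .
qed

lemma pmf_shared_query:
  assumes "q \<in> words n M"
  shows "pmf (map_pmf (shared_query n l) (scheme_pmf M n z)) q =
    1 / real n * (1 / real M * (\<Sum>m = 1..M. Poly_Mapping.lookup z (remove_coord m q)))"
proof -
  let ?J = "joint_pmf M n z l"
  have "map_pmf (shared_query n l) (scheme_pmf M n z) = map_pmf snd ?J"
    by (simp only: map_pmf_comp snd_conv)
  moreover have "pmf (map_pmf snd ?J) q = (\<Sum>m\<in>{1..M}. pmf ?J (m, q))"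
    by (rule pmf_map_snd[OF finite_atLeastAtMost]) (use set_joint_pmf in blast)
  ultimately have "pmf (map_pmf (shared_query n l) (scheme_pmf M n z)) q = (\<Sum>m = 1..M. pmf ?J (m, q))"
    by (simp only:)
  also have "\<dots> = (\<Sum>m = 1..M. Poly_Mapping.lookup z (remove_coord m q) / (real M * real n))"
    using assms by (intro sum.cong refl pmf_joint)
  also have "\<dots> = 1 / real n * (1 / real M * (\<Sum>m = 1..M. Poly_Mapping.lookup z (remove_coord m q)))"
    by (simp only: sum_divide_distrib[symmetric]) simp
  finally show ?thesis .
qed

section \<open>Closed forms of the leakage at one server\<close>

text \<open>The factors 1 / M and 1 / n cancel inside the logarithm of joint mass over product of
  marginals. Convexity is read off from this form; the difference of entropies below does not
  display it.\<close>

lemma server_MI_eq_divergence: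
  "server_MI M n z l = 1 / (real n * real M) * (\<Sum>q\<in>words n M. \<Sum>m = 1..M.
     Poly_Mapping.lookup z (remove_coord m q) * log 2 (Poly_Mapping.lookup z (remove_coord m q) /
       (1 / real M * (\<Sum>m = 1..M. Poly_Mapping.lookup z (remove_coord m q)))))"
proof -
  let ?J = "joint_pmf M n z l"
  let ?a = "\<lambda>m q. Poly_Mapping.lookup z (remove_coord m q)"
  let ?A = "\<lambda>q. 1 / real M * (\<Sum>m = 1..M. ?a m q)"
  have n: "n > 0" using l by auto
  have "server_MI M n z l = (\<Sum>w\<in>{1..M} \<times> words n M. pmf ?J w * log 2 (pmf ?J w /
      (pmf (map_pmf requested (scheme_pmf M n z)) (fst w) *
       pmf (map_pmf (shared_query n l) (scheme_pmf M n z)) (snd w))))"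
    unfolding server_MI_def
    by (rule mutual_information_measure_pmf[OF _ _ set_joint_pmf]) (simp_all add: finite_words)
  also have "\<dots> = (\<Sum>(m, q)\<in>{1..M} \<times> words n M. 1 / (real n * real M) * (?a m q * log 2 (?a m q / ?A q)))"
  proof (rule sum.cong[OF refl])
    fix w assume "w \<in> {1..M} \<times> words n M"
    then obtain m q where w: "w = (m, q)" "m \<in> {1..M}" "q \<in> words n M" by auto
    have J: "pmf ?J w = ?a m q / (real M * real n)"
      using pmf_joint[OF w(2,3)] by (simp only: w(1))
    have X: "pmf (map_pmf requested (scheme_pmf M n z)) (fst w) = 1 / real M"
      unfolding map_requested using w M by simp
    have Y: "pmf (map_pmf (shared_query n l) (scheme_pmf M n z)) (snd w) = 1 / real n * ?A q"
      using pmf_shared_query[OF w(3)] by (simp only: w(1) snd_conv)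
    \<comment> \<open>For y = 0 both sides are 0 by the convention for division by 0.\<close>
    have ratio: "x / (real M * real n) / (1 / real M * (1 / real n * y)) = x / y" for x y
      using M n by (cases "y = 0") (simp_all add: field_simps)
    show "pmf ?J w * log 2 (pmf ?J w / (pmf (map_pmf requested (scheme_pmf M n z)) (fst w) *
          pmf (map_pmf (shared_query n l) (scheme_pmf M n z)) (snd w))) =
        (case w of (m, q) \<Rightarrow> 1 / (real n * real M) * (?a m q * log 2 (?a m q / ?A q)))"
      unfolding J X Y ratio by (simp only: w(1) prod.case) simp
  qed
  also have "\<dots> = (\<Sum>m = 1..M. \<Sum>q\<in>words n M. 1 / (real n * real M) * (?a m q * log 2 (?a m q / ?A q)))"
    by (simp add: sum.cartesian_product)
  also have "\<dots> = (\<Sum>q\<in>words n M. \<Sum>m = 1..M. 1 / (real n * real M) * (?a m q * log 2 (?a m q / ?A q)))"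
    by (rule sum.swap)
  finally show ?thesis
    by (simp only: sum_distrib_left)
qed

text \<open>Splitting the logarithm of the quotient, the numerators sum to n M copies of -H(z) by
  coordinate deletion, and the denominators collect into the sum over the averaged entries.\<close>

lemma server_MI_eq_entropies:
  "server_MI M n z l =
     - (1 / real n) * (\<Sum>q\<in>words n M.
       (1 / real M * (\<Sum>m = 1..M. Poly_Mapping.lookup z (remove_coord m q))) *
       log 2 (1 / real M * (\<Sum>m = 1..M. Poly_Mapping.lookup z (remove_coord m q))))
     - vector_entropy M n z"
proof -
  let ?a = "\<lambda>m q. Poly_Mapping.lookup z (remove_coord m q)"
  let ?A = "\<lambda>q. 1 / real M * (\<Sum>m = 1..M. ?a m q)"
  have n: "n > 0" using l by auto
  \<comment> \<open>A zero entry makes both sides vanish through the factor in front; for a positive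
    entry the average is positive too, as it contains 1 / M of that entry.\<close>
  have split: "?a m q * log 2 (?a m q / ?A q) = ?a m q * log 2 (?a m q) - ?a m q * log 2 (?A q)"
    if "m \<in> {1..M}" for m q
  proof (cases "?a m q = 0")
    case False
    then have a: "0 < ?a m q" using lookup_nonneg[OF z, of "remove_coord m q"] by linarith
    also have "\<dots> \<le> (\<Sum>m = 1..M. ?a m q)"
      using that lookup_nonneg[OF z] by (intro member_le_sum) auto
    finally have "0 < ?A q" using M by simp
    then have "log 2 (?a m q / ?A q) = log 2 (?a m q) - log 2 (?A q)"
      using a by (intro log_divide_pos)
    then show ?thesis by (simp only: right_diff_distrib)
  qed simp
  have "(\<Sum>q\<in>words n M. \<Sum>m = 1..M. ?a m q * log 2 (?a m q / ?A q)) =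
      (\<Sum>q\<in>words n M. \<Sum>m = 1..M. ?a m q * log 2 (?a m q)) -
      (\<Sum>q\<in>words n M. (\<Sum>m = 1..M. ?a m q) * log 2 (?A q))"
    by (simp only: split sum_subtractf sum_distrib_right cong: sum.cong)
  also have "(\<Sum>q\<in>words n M. \<Sum>m = 1..M. ?a m q * log 2 (?a m q)) =
      (\<Sum>m = 1..M. \<Sum>q\<in>words n M. ?a m q * log 2 (?a m q))"
    by (rule sum.swap)
  also have "\<dots> = (\<Sum>m = 1..M. real n * - vector_entropy M n z)"
    unfolding vector_entropy_def minus_minus
    by (intro sum.cong refl sum_words_remove_coord)
  also have "\<dots> = - (real M * real n * vector_entropy M n z)"
    by simp
  also have "(\<Sum>q\<in>words n M. (\<Sum>m = 1..M. ?a m q) * log 2 (?A q)) =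
      real M * (\<Sum>q\<in>words n M. ?A q * log 2 (?A q))"
    using M by (subst sum_distrib_left) simp
  finally have divergence: "(\<Sum>q\<in>words n M. \<Sum>m = 1..M. ?a m q * log 2 (?a m q / ?A q)) =
      - (real M * real n * vector_entropy M n z) - real M * (\<Sum>q\<in>words n M. ?A q * log 2 (?A q))" .
  have "1 / (real n * real M) * (- (real M * real n * h) - real M * b) = - (1 / real n) * b - h" for h b
    using M n by (simp add: field_simps)
  then show ?thesis
    unfolding server_MI_eq_divergence divergence .
qed

lemma server_MaxL_eq:
  "server_MaxL M n z l =
     log 2 (\<Sum>q\<in>words n M. MAX m\<in>{1..M}. Poly_Mapping.lookup z (remove_coord m q) / real n)"
proof -
  have "\<P>(\<omega> in measure_pmf (scheme_pmf M n z). shared_query n l \<omega> = q \<bar> requested \<omega> = m) =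
      Poly_Mapping.lookup z (remove_coord m q) / real n" if "q \<in> words n M" "m \<in> {1..M}" for q m
  proof -
    have "measure_pmf.prob (scheme_pmf M n z) {\<omega>. shared_query n l \<omega> = q \<and> requested \<omega> = m} =
        pmf (joint_pmf M n z l) (m, q)"
      unfolding pmf_map by (rule arg_cong[where f = "measure_pmf.prob _"]) auto
    moreover have "measure_pmf.prob (scheme_pmf M n z) {\<omega>. requested \<omega> = m} =
        pmf (map_pmf requested (scheme_pmf M n z)) m"
      unfolding pmf_map by (rule arg_cong[where f = "measure_pmf.prob _"]) auto
    moreover have "pmf (pmf_of_set {1..M}) m = 1 / real M"
      using that M by simp
    ultimately show ?thesis
      using that M by (simp add: cond_prob_def map_requested pmf_joint)
  qed
  then show ?thesis
    unfolding server_MaxL_def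
    by (intro arg_cong[where f = "log 2"] sum.cong refl arg_cong[where f = Max] image_cong)
qed

end

section \<open>Equal leakage at all servers, and convexity in z\<close>

text \<open>The closed form at a server does not involve l, so the average over servers equals each
  of its terms. The maximum in \<open>rho_MaxL_eq\<close> is treated the same way.\<close>

lemma rho_MI_eq:
  assumes "M > 0" "z \<in> pmf_vectors M n" "l \<in> {1..n}"
  shows "rho_MI M n z = server_MI M n z l"
proof -
  have "(\<Sum>k = 1..n. server_MI M n z k) = (\<Sum>k = 1..n. server_MI M n z l)"
    by (intro sum.cong refl) (simp only: server_MI_eq_entropies[OF assms(1,2)] assms(3))
  then show ?thesis
    using assms(3) by (simp add: rho_MI_def)
qed

lemma rho_MaxL_eq:
  assumes "M > 0" "z \<in> pmf_vectors M n" "l \<in> {1..n}"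
  shows "rho_MaxL M n z = server_MaxL M n z l"
proof -
  have "server_MaxL M n z ` {1..n} = (\<lambda>_. server_MaxL M n z l) ` {1..n}"
    by (intro image_cong refl) (simp only: server_MaxL_eq[OF assms(1,2)] assms(3))
  then show ?thesis
    using assms(3) by (simp add: rho_MaxL_def image_constant_conv)
qed

lemma convex_on_rho_MI:
  assumes "M > 0" "n > 0"
  shows "convex_on (pmf_vectors M n) (rho_MI M n)"
proof -
  let ?a = "\<lambda>m q z. Poly_Mapping.lookup z (remove_coord m q) :: real"
  let ?A = "\<lambda>q z. 1 / real M * (\<Sum>m = 1..M. ?a m q z)"
  have A: "linear (?A q)" for q
    by (rule linearI)
      (simp_all add: lookup_add lookup_scaleR sum.distrib algebra_simps flip: sum_distrib_left)
  have "convex_on (pmf_vectors M n) (\<lambda>z. ?a m q z * log 2 (?a m q z / ?A q z))"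
    if m: "m \<in> {1..M}" for m q
  proof (rule convex_on_xlogx_over_linear)
    fix z assume z: "z \<in> pmf_vectors M n"
    show "0 \<le> ?A q z"
      using lookup_nonneg[OF z] by (simp add: sum_nonneg)
    \<comment> \<open>A sum of nonnegative entries vanishes only if each of them does.\<close>
    show "?a m q z = 0" if "?A q z = 0"
      using that m assms lookup_nonneg[OF z] by (simp add: sum_nonneg_eq_0_iff)
  qed (rule convex_pmf_vectors linear_lookup A | erule lookup_nonneg | simp)+
  then have "convex_on (pmf_vectors M n) (\<lambda>z. 1 / (real n * real M) *
      (\<Sum>q\<in>words n M. \<Sum>m = 1..M. ?a m q z * log 2 (?a m q z / ?A q z)))"
    by (intro convex_on_cmul convex_on_sum_fun convex_pmf_vectors) simp_all
  \<comment> \<open>The closed form is available on PMF vectors only, so convexity is transferred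
    through agreement on that convex set, with server 1 as representative.\<close>
  moreover have "rho_MI M n z = 1 / (real n * real M) *
      (\<Sum>q\<in>words n M. \<Sum>m = 1..M. ?a m q z * log 2 (?a m q z / ?A q z))"
    if "z \<in> pmf_vectors M n" for z
    using rho_MI_eq[OF assms(1) that, of 1] server_MI_eq_divergence[OF assms(1) that, of 1] assms
    by simp
  ultimately show ?thesis
    by (simp add: convex_on_def convexD)
qed

lemma convex_on_powr_rho_MaxL:
  assumes "M > 0" "n > 0"
  shows "convex_on (pmf_vectors M n) (\<lambda>z. 2 powr rho_MaxL M n z)"
proof -
  let ?F = "\<lambda>z. \<Sum>q\<in>words n M. MAX m\<in>{1..M}. Poly_Mapping.lookup z (remove_coord m q) / real n"
  have "convex_on (pmf_vectors M n) ?F"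
  proof (intro convex_on_sum_fun convex_on_Max convex_pmf_vectors)
    show "convex_on (pmf_vectors M n) (\<lambda>z. Poly_Mapping.lookup z (remove_coord m q) / real n)" for m q
      by (auto simp: convex_on_def convex_pmf_vectors lookup_add lookup_scaleR add_divide_distrib)
  qed (use assms in auto)
  moreover have "2 powr rho_MaxL M n z = ?F z" if z: "z \<in> pmf_vectors M n" for z
  proof -
    \<comment> \<open>To cancel \<open>2 powr\<close> against \<open>log 2\<close> the sum of maxima
      must be positive. Bounding each maximum below by its term m = 1 leaves the total mass of z, so
      the sum is at least 1.\<close>
    have "1 = (\<Sum>s\<in>words n (M - 1). Poly_Mapping.lookup z s)"
      using z by (simp add: pmf_vectors_def)
    also have "\<dots> = (\<Sum>q\<in>words n M. Poly_Mapping.lookup z (remove_coord 1 q) / real n)"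
      using assms sum_words_remove_coord[of 1 M "Poly_Mapping.lookup z" n]
      by (simp flip: sum_divide_distrib)
    also have "\<dots> \<le> ?F z"
      using assms by (intro sum_mono Max_ge) auto
    finally show ?thesis
      using rho_MaxL_eq[OF assms(1) z, of 1] server_MaxL_eq[OF assms(1) z, of 1] assms
      by simp
  qed
  ultimately show ?thesis
    by (simp add: convex_on_def convexD)
qed

theorem mainTheorem12:
  fixes M n :: nat
  assumes "M \<ge> 2" and "n \<ge> 2"
  shows
    "(\<forall>z\<in>pmf_vectors M n.
        (\<forall>l\<in>{1..n}. server_MI M n z l = rho_MI M n z) \<and>
        (\<forall>l\<in>{1..n}. server_MaxL M n z l = rho_MaxL M n z) \<and>
        rho_MI M n z =
          - (1 / real n) * (\<Sum>q\<in>words n M.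
               (1 / real M * (\<Sum>m = 1..M. Poly_Mapping.lookup z (remove_coord m q))) *
               log 2 (1 / real M * (\<Sum>m = 1..M. Poly_Mapping.lookup z (remove_coord m q))))
          - vector_entropy M n z \<and>
        rho_MaxL M n z =
          log 2 (\<Sum>q\<in>words n M. MAX m\<in>{1..M}. Poly_Mapping.lookup z (remove_coord m q) / real n)) \<and>
     (\<forall>D :: real.
        convex (feasible M n D) \<and>
        convex_on (feasible M n D) (rho_MI M n) \<and>
        convex_on (feasible M n D) (\<lambda>z. 2 powr rho_MaxL M n z))"
proof -
  have pos: "M > 0" "n > 0" and one: "1 \<in> {1..n}"
    using assms by auto
  \<comment> \<open>Both objectives are convex on all PMF vectors, and the cost constraint cuts out
    a convex subset.\<close>
  have "convex_on (feasible M n D) f" if "convex_on (pmf_vectors M n) f" for f D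
    using that by (rule convex_on_subset) (simp_all add: convex_feasible, simp add: feasible_def)
  then have "\<forall>D. convex (feasible M n D) \<and> convex_on (feasible M n D) (rho_MI M n) \<and>
      convex_on (feasible M n D) (\<lambda>z. 2 powr rho_MaxL M n z)"
    using convex_feasible convex_on_rho_MI[OF pos] convex_on_powr_rho_MaxL[OF pos] by blast
  moreover have "(\<forall>l\<in>{1..n}. server_MI M n z l = rho_MI M n z) \<and>
      (\<forall>l\<in>{1..n}. server_MaxL M n z l = rho_MaxL M n z)"
    if "z \<in> pmf_vectors M n" for z
    using rho_MI_eq[OF pos(1) that] rho_MaxL_eq[OF pos(1) that] by simp
  moreover note trans[OF rho_MI_eq[OF pos(1) _ one] server_MI_eq_entropies[OF pos(1) _ one]]
    trans[OF rho_MaxL_eq[OF pos(1) _ one] server_MaxL_eq[OF pos(1) _ one]]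
  ultimately show ?thesis
    by blast
qed

end
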